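(* Let $m$ be an odd positive integer with $m = 2n-1$, $n \ge 2$, and write $m = 2^p(2q+1) - 1$ with $p \ge 1$, $q \ge 0$. The following are equivalent: (1) $T^p(m) \equiv 0 \pmod 4$; (2) $p$ and $q$ have the same parity; (3) $C(n) = 1$.
   Context: $T:\mathbb{Z}^+\to\mathbb{Z}^+$ is defined by $T(x) = x/2$ if $x$ is even and $T(x) = (3x+1)/2$ if $x$ is odd; $T^k$ denotes the $k$-fold iterate. The function $C:\mathbb{Z}^+\to\{0,1\}$ is defined recursively by $C(1) = 0$, $C(n) = 1 - C(n-2)$ if $n > 1$ is odd, and $C(n) = 1 - C(n/2)$ if $n$ is even. *)

theory Defs
  imports Main "HOL-Number_Theory.Cong"
begin

text \<open>
  The positive integers are rendered as \<^typ>\<open>nat\<close>; the values of \<open>T\<close> and \<open>C\<close> at \<open>0\<close> are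
  junk, and neither recursion ever reaches \<open>0\<close> from a positive argument.
\<close>

definition T :: "nat \<Rightarrow> nat" where
  "T x = (if even x then x div 2 else (3 * x + 1) div 2)"

text \<open>
  The codomain \<open>{0, 1}\<close> is embedded in \<^typ>\<open>int\<close>, so that \<open>1 - C n\<close> is a genuine subtraction.
\<close>

fun C :: "nat \<Rightarrow> int" where
  "C n = (if n \<le> 1 then 0 else if odd n then 1 - C (n - 2) else 1 - C (n div 2))"

declare C.simps [simp del]

lemma C_1: "C 1 = 0"
  by (simp add: C.simps)

lemma C_odd: "n > 1 \<Longrightarrow> odd n \<Longrightarrow> C n = 1 - C (n - 2)"
  by (subst C.simps) simp

lemma C_even: "n > 0 \<Longrightarrow> even n \<Longrightarrow> C n = 1 - C (n div 2)"
  by (subst C.simps) (auto simp: le_Suc_eq)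

lemma C_range: "C n \<in> {0, 1}"
proof (induction n rule: C.induct)
  case (1 n)
  then show ?case
    by (subst C.simps) auto
qed

end

theory Submission
  imports Defs
begin

text \<open>
  Each of the first \<open>p\<close> steps of \<open>T\<close> from \<open>2 ^ p * a - 1\<close> trades a factor \<open>2\<close> of \<open>m + 1\<close> for a
  factor \<open>3\<close>, so \<open>T\<^sup>p(m) = 3 ^ p * (2 * q + 1) - 1\<close>. Modulo \<open>4\<close> both \<open>3\<close> and \<open>2 * q + 1\<close> are signs,
  namely \<open>-1\<close> and \<open>(-1) ^ q\<close>, hence (1) says that \<open>p + q\<close> is even. On the other side
  \<open>n = 2 ^ (p - 1) * (2 * q + 1)\<close>, and the recursion for \<open>C\<close> flips its value \<open>p - 1 + q\<close> times
  on the way from \<open>n\<close> to \<open>1\<close>.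
\<close>

text \<open>With \<open>b = 2 ^ k * a\<close>, the odd number \<open>2 * b - 1\<close> goes to
  \<open>(3 * (2 * b - 1) + 1) div 2 = 3 * b - 1\<close>.\<close>

lemma T_pow2_Suc:
  assumes "a > 0"
  shows "T (2 ^ Suc k * a - 1) = 2 ^ k * (3 * a) - 1"
proof -
  have "2 ^ k * a > 0" using assms by simp
  then obtain j where "2 ^ k * a = Suc j" using gr0_implies_Suc by blast
  then show ?thesis by (simp add: T_def mult.assoc mult.left_commute[of _ 3])
qed

lemma T_funpow_pow2:
  assumes "a > 0"
  shows "(T ^^ p) (2 ^ p * a - 1) = 3 ^ p * a - 1"
  using assms
\<comment> \<open>\<open>a\<close> must vary, since each step of \<open>T\<close> moves a factor 3
  into it.\<close>
proof (induction p arbitrary: a)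
  case (Suc p)
  have "(T ^^ Suc p) (2 ^ Suc p * a - 1) = (T ^^ p) (2 ^ p * (3 * a) - 1)"
    by (simp only: funpow_Suc_right o_apply T_pow2_Suc[OF Suc.prems])
  also have "\<dots> = 3 ^ Suc p * a - 1"
    using Suc.IH[of "3 * a"] Suc.prems by (simp add: ac_simps)
  finally show ?case .
qed simp

lemma pow3_mult_odd_mod_4:
  "3 ^ p * (2 * q + 1) mod 4 = (if even p \<longleftrightarrow> even q then 1 else 3 :: nat)"
proof (induction p)
  case 0
  have "(2 * q + 1) mod 4 = (if even q then 1 else 3)" by presburger
  then show ?case by simp
next
  case (Suc p)
  have "3 ^ Suc p * (2 * q + 1) mod 4 = 3 * (3 ^ p * (2 * q + 1) mod 4) mod 4"
    by (simp only: power_Suc mult.assoc mod_mult_right_eq)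
  then show ?case by (simp only: Suc.IH) simp
qed

lemma C_double_plus_1: "C (2 * q + 1) = (if even q then 0 else 1)"
proof (induction q)
  case 0
  show ?case using C_1 by simp
next
  case (Suc q)
  then show ?case using C_odd[of "2 * Suc q + 1"] by simp
qed

lemma C_pow2_mult_odd:
  "C (2 ^ k * (2 * q + 1)) = (if even k \<longleftrightarrow> even q then 0 else 1)"
proof (induction k)
  case 0
  show ?case using C_double_plus_1[of q] by simp
next
  case (Suc k)
  have "C (2 ^ Suc k * (2 * q + 1)) = 1 - C (2 ^ k * (2 * q + 1))"
    using C_even[of "2 * (2 ^ k * (2 * q + 1))"]
    by (simp del: mult_Suc_right distrib_left_numeral add: mult.assoc)
  then show ?case by (simp only: Suc.IH) simp
qed

theorem theorem3p2:
  fixes m n p q :: nat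
  assumes "odd m"
    and "m = 2 * n - 1"
    and "n \<ge> 2"
    and "m = 2 ^ p * (2 * q + 1) - 1"
    and "p \<ge> 1"
  shows "([(T ^^ p) m = 0] (mod 4) \<longleftrightarrow> (even p \<longleftrightarrow> even q))
    \<and> ((even p \<longleftrightarrow> even q) \<longleftrightarrow> C n = 1)"
proof
  define N :: nat where "N = 3 ^ p * (2 * q + 1)"
  have "N > 0" by (simp add: N_def)
  have "(T ^^ p) m = N - 1"
    using T_funpow_pow2[of "2 * q + 1" p] assms(4) by (simp add: N_def)
  \<comment> \<open>Positivity matters here: truncated subtraction gives \<open>N - 1 = 0\<close> at
    \<open>N = 0\<close>.\<close>
  moreover have "(N - 1) mod 4 = 0 \<longleftrightarrow> N mod 4 = 1"
    using \<open>N > 0\<close> by presburger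
  moreover have "N mod 4 = 1 \<longleftrightarrow> (even p \<longleftrightarrow> even q)"
    unfolding N_def pow3_mult_odd_mod_4 by simp
  ultimately show "[(T ^^ p) m = 0] (mod 4) \<longleftrightarrow> (even p \<longleftrightarrow> even q)"
    by (simp add: cong_def)
next
  obtain k where k: "p = Suc k" using assms(5) by (cases p) auto
  have "2 ^ p * (2 * q + 1) > 0" by simp
  then have "2 * n = 2 ^ p * (2 * q + 1)" using assms(2-4) by linarith
  then have "n = 2 ^ k * (2 * q + 1)" unfolding k by simp
  then have "C n = (if even k \<longleftrightarrow> even q then 0 else 1)" by (simp only: C_pow2_mult_odd)
  \<comment> \<open>\<open>k\<close> is \<open>p - 1\<close>, of parity opposite to
    \<open>p\<close>, so equal parity of \<open>p\<close> and \<open>q\<close> gives the value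
    1.\<close>
  then show "(even p \<longleftrightarrow> even q) \<longleftrightarrow> C n = 1" by (auto simp: k)
qed

end
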